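(* Every finite directed graph $D$ has a linked directed path-decomposition of width $\mathrm{dpw}(D)$, where $\mathrm{dpw}(D)$ is the directed path-width of $D$.
   Context: Let $D=(V,E)$ be a finite directed graph. A directed path-decomposition of $D$ is a pair $(P,\mathcal V)$ consisting of a path $P$ with vertices $t_1,\dots,t_n$ in this order ($n\ge 1$) and a family $\mathcal V=(V_i)_{1\le i\le n}$ of subsets of $V$ such that: (i) $V=\bigcup_{i} V_i$; (ii) if $i<j<l$ then $V_i\cap V_l\subseteq V_j$; (iii) for every edge $(x,y)\in E$ there exist $i\le j$ with $x\in V_i$ and $y\in V_j$. Its width is $\max_i |V_i|-1$. The directed path-width $\mathrm{dpw}(D)$ is the smallest width of a directed path-decomposition of $D$. A (directed) separation of $D$ is a pair $(A,B)$ of subsets of $V$ with $A\cup B=V$ such that there is no edge $(x,y)\in E$ with $x\in B\setminus A$ and $y\in A\setminus B$. Its order is $|A,B|:=|A\cap B|$. Let $\overrightarrow{S}$ be the set of all separations, partially ordered by $(A,B)\le (C,D')$ iff $A\subseteq C$ and $B\supseteq D'$. For separations $(A,B)\le (C,D')$ put $$\lambda\big((A,B),(C,D')\big)=\min\{|X,Y| : (X,Y)\in\overrightarrow{S},\ (A,B)\le (X,Y)\le (C,D')\}.$$ A directed path-decomposition $(P,\mathcal V)$ of $D$, where $P$ is a path with vertices $t_1,\dots,t_n$ in this order and $\mathcal V=(V_i)_{1\le i\le n}$, induces, for $1\le i\le n-1$, the separations $(A_i,B_i)=\big(\bigcup_{j\le i}V_j,\ \bigcup_{j\ge i+1}V_j\big)$,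 which satisfy $(A_i,B_i)\le (A_j,B_j)$ for $i<j$. It is linked if for all $1\le i<j\le n-1$ $$\min\{|A_l,B_l| : i\le l\le j\}=\lambda\big((A_i,B_i),(A_j,B_j)\big).$$ *)

theory Defs
  imports "Graph_Theory.Pair_Digraph"
begin

text \<open>
  The bags of a decomposition along a path \<open>t\<^sub>1, \<dots>, t\<^sub>n\<close> are given by \<open>n\<close> and a function
  \<open>W\<close>, of which only the values \<open>W 1, \<dots>, W n\<close> are ever used.
\<close>

definition directed_path_decomposition ::
    "'a pair_pre_digraph \<Rightarrow> nat \<Rightarrow> (nat \<Rightarrow> 'a set) \<Rightarrow> bool" where
  "directed_path_decomposition D n W \<longleftrightarrow>
     1 \<le> n \<and>
     (\<forall>i\<in>{1..n}. W i \<subseteq> pverts D) \<and>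
     pverts D = (\<Union>i\<in>{1..n}. W i) \<and>
     (\<forall>i\<in>{1..n}. \<forall>j\<in>{1..n}. \<forall>l\<in>{1..n}. i < j \<and> j < l \<longrightarrow> W i \<inter> W l \<subseteq> W j) \<and>
     (\<forall>(x, y)\<in>parcs D. \<exists>i\<in>{1..n}. \<exists>j\<in>{1..n}. i \<le> j \<and> x \<in> W i \<and> y \<in> W j)"

text \<open>Widths are integers, since the graph without vertices has directed path-width \<open>-1\<close>.\<close>

definition dpd_width :: "nat \<Rightarrow> (nat \<Rightarrow> 'a set) \<Rightarrow> int" where
  "dpd_width n W = int (Max ((\<lambda>i. card (W i)) ` {1..n})) - 1"

definition dpw :: "'a pair_pre_digraph \<Rightarrow> int" where
  "dpw D = (LEAST w. \<exists>n W. directed_path_decomposition D n W \<and> w = dpd_width n W)"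

definition dseparations :: "'a pair_pre_digraph \<Rightarrow> ('a set \<times> 'a set) set" where
  "dseparations D = {(A, B). A \<subseteq> pverts D \<and> B \<subseteq> pverts D \<and> A \<union> B = pverts D \<and>
     \<not> (\<exists>(x, y)\<in>parcs D. x \<in> B - A \<and> y \<in> A - B)}"

definition sep_order :: "'a set \<times> 'a set \<Rightarrow> nat" where
  "sep_order S = card (fst S \<inter> snd S)"

text \<open>The product order on pairs of sets is componentwise inclusion, hence a separate relation.\<close>

definition sep_le :: "'a set \<times> 'a set \<Rightarrow> 'a set \<times> 'a set \<Rightarrow> bool" where
  "sep_le S T \<longleftrightarrow> fst S \<subseteq> fst T \<and> snd T \<subseteq> snd S"

definition sep_lambda ::
    "'a pair_pre_digraph \<Rightarrow> 'a set \<times> 'a set \<Rightarrow> 'a set \<times> 'a set \<Rightarrow> nat" where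
  "sep_lambda D S T = Min {sep_order X | X. X \<in> dseparations D \<and> sep_le S X \<and> sep_le X T}"

definition induced_sep :: "nat \<Rightarrow> (nat \<Rightarrow> 'a set) \<Rightarrow> nat \<Rightarrow> 'a set \<times> 'a set" where
  "induced_sep n W i = (\<Union>j\<in>{1..i}. W j, \<Union>j\<in>{i+1..n}. W j)"

definition linked :: "'a pair_pre_digraph \<Rightarrow> nat \<Rightarrow> (nat \<Rightarrow> 'a set) \<Rightarrow> bool" where
  "linked D n W \<longleftrightarrow>
     (\<forall>i j. 1 \<le> i \<and> i < j \<and> j \<le> n - 1 \<longrightarrow>
        Min {sep_order (induced_sep n W l) | l. i \<le> l \<and> l \<le> j} =
        sep_lambda D (induced_sep n W i) (induced_sep n W j))"

text \<open>
  Well-definedness: the least width is attained and is a lower bound, and the minimum in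
  \<^const>\<open>sep_lambda\<close> ranges over a finite non-empty set.
\<close>

lemma dpw_attained_and_least:
  fixes D :: "'a pair_pre_digraph"
  assumes "pair_fin_digraph D"
  shows "\<exists>n W. directed_path_decomposition D n W \<and> dpd_width n W = dpw D"
    and "directed_path_decomposition D n W \<Longrightarrow> dpw D \<le> dpd_width n W"
proof -
  interpret pair_fin_digraph D by fact
  let ?P = "\<lambda>k. \<exists>n W. directed_path_decomposition D n W \<and> int k - 1 = dpd_width n W"
  have "directed_path_decomposition D 1 (\<lambda>_. pverts D)"
    unfolding directed_path_decomposition_def
    using in_arcsD1 in_arcsD2 by fastforce
  then have ex: "\<exists>k. ?P k" unfolding dpd_width_def by fast
  define m where "m = (LEAST k. ?P k)"
  have m: "?P m" unfolding m_def by (rule LeastI_ex[OF ex])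
  have le: "int m - 1 \<le> dpd_width n W" if "directed_path_decomposition D n W" for n W
  proof -
    have "?P (Max ((\<lambda>i. card (W i)) ` {1..n}))" using that unfolding dpd_width_def by blast
    then have "m \<le> Max ((\<lambda>i. card (W i)) ` {1..n})" unfolding m_def by (rule Least_le)
    then show ?thesis unfolding dpd_width_def by linarith
  qed
  have eq: "dpw D = int m - 1"
    unfolding dpw_def by (rule Least_equality) (use m le in auto)
  show "\<exists>n W. directed_path_decomposition D n W \<and> dpd_width n W = dpw D"
    using m eq by metis
  show "directed_path_decomposition D n W \<Longrightarrow> dpw D \<le> dpd_width n W"
    using le eq by auto
qed

lemma induced_sep_le:
  assumes "i \<le> j"
  shows "sep_le (induced_sep n W i) (induced_sep n W j)"
proof -
  have "{1..i} \<subseteq> {1..j}" "{j+1..n} \<subseteq> {i+1..n}" using assms by auto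
  then show ?thesis unfolding sep_le_def induced_sep_def fst_conv snd_conv by blast
qed

lemma induced_sep_in_dseparations:
  assumes "directed_path_decomposition D n W" "1 \<le> i" "i \<le> n - 1"
  shows "induced_sep n W i \<in> dseparations D"
proof -
  have un: "pverts D = (\<Union>k\<in>{1..n}. W k)"
    using assms(1) unfolding directed_path_decomposition_def by blast
  have "{1..n} = {1..i} \<union> {i+1..n}" using assms by auto
  then have cover: "pverts D = (\<Union>k\<in>{1..i}. W k) \<union> (\<Union>k\<in>{i+1..n}. W k)"
    unfolding un by (simp only: UN_Un)
  have cross: "x \<in> (\<Union>k\<in>{1..i}. W k) \<or> y \<in> (\<Union>k\<in>{i+1..n}. W k)"
    if e: "(x, y) \<in> parcs D" for x y
  proof -
    have "\<forall>(x, y)\<in>parcs D. \<exists>i\<in>{1..n}. \<exists>j\<in>{1..n}. i \<le> j \<and> x \<in> W i \<and> y \<in> W j"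
      using assms(1) unfolding directed_path_decomposition_def by (elim conjE)
    from bspec[OF this e]
    obtain a b where ab: "a \<in> {1..n}" "b \<in> {1..n}" "a \<le> b" "x \<in> W a" "y \<in> W b"
      unfolding prod.case by (elim bexE conjE)
    show ?thesis
    proof (cases "a \<le> i")
      case True
      then have "a \<in> {1..i}" using ab by simp
      then show ?thesis using ab by blast
    next
      case False
      then have "b \<in> {i+1..n}" using ab by simp
      then show ?thesis using ab by blast
    qed
  qed
  show ?thesis
    unfolding dseparations_def induced_sep_def
  proof (rule CollectI, unfold prod.case, intro conjI)
    show "(\<Union>k\<in>{1..i}. W k) \<subseteq> pverts D" "(\<Union>k\<in>{i+1..n}. W k) \<subseteq> pverts D"
      "(\<Union>k\<in>{1..i}. W k) \<union> (\<Union>k\<in>{i+1..n}. W k) = pverts D"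
      unfolding cover by (rule Un_upper1 Un_upper2 refl)+
    show "\<not> (\<exists>(x, y)\<in>parcs D. x \<in> (\<Union>k\<in>{i+1..n}. W k) - (\<Union>k\<in>{1..i}. W k) \<and>
        y \<in> (\<Union>k\<in>{1..i}. W k) - (\<Union>k\<in>{i+1..n}. W k))"
      using cross by blast
  qed
qed

lemma sep_lambda_range:
  fixes D :: "'a pair_pre_digraph"
  assumes "pair_fin_digraph D" "S \<in> dseparations D" "T \<in> dseparations D" "sep_le S T"
  shows "finite {sep_order X | X. X \<in> dseparations D \<and> sep_le S X \<and> sep_le X T}"
    and "{sep_order X | X. X \<in> dseparations D \<and> sep_le S X \<and> sep_le X T} \<noteq> {}"
proof -
  interpret pair_fin_digraph D by fact
  have "dseparations D \<subseteq> Pow (pverts D) \<times> Pow (pverts D)"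
    unfolding dseparations_def by auto
  then have fin: "finite (dseparations D)"
    by (rule finite_subset) simp
  show "finite {sep_order X | X. X \<in> dseparations D \<and> sep_le S X \<and> sep_le X T}"
    by (rule finite_subset[OF _ finite_imageI[OF fin, of sep_order]]) blast
  show "{sep_order X | X. X \<in> dseparations D \<and> sep_le S X \<and> sep_le X T} \<noteq> {}"
    using assms unfolding sep_le_def by blast
qed

end

theory Submission
  imports Defs
begin

text \<open>
  A directed path-decomposition with bags \<open>W 1, \<dots>, W n\<close> carries the same information as the chain
  \<open>C 0 \<le> C 1 \<le> \<dots> \<le> C n\<close> of its induced separations, extended by the trivial ones
  \<open>C 0 = (\<emptyset>, V)\<close> and \<open>C n = (V, \<emptyset>)\<close>: the bag \<open>W (k+1)\<close> is the intersection of the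
  first side of \<open>C (k+1)\<close> with the second side of \<open>C k\<close>
  (\<open>separation_chain_if_dpd\<close>, \<open>dpd_if_separation_chain\<close>). Linkedness is a
  property of the chain alone, so it suffices to find a good chain all of whose bags have at most
  \<open>dpw D + 1\<close> vertices.

  Suppose that such a chain is not linked between \<open>C i\<close> and \<open>C j\<close>, so that some separation
  \<open>X\<close> with \<open>C i \<le> X \<le> C j\<close> of minimum order has smaller order than each of
  \<open>C i, \<dots>, C j\<close>. Follow the meets of \<open>C 0, \<dots>, C j\<close> with \<open>X\<close>, which end in
  \<open>X\<close>, by the joins of \<open>C (i+1), \<dots>, C n\<close> with \<open>X\<close>. This is again a
  chain, and by submodularity and the minimality of \<open>X\<close> no bag has become larger than the old
  bag from which it comes (\<open>chain_splice\<close>). The new chain contains \<open>X\<close>, which the old one did not, and it keeps every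
  old separation outside the range from \<open>i\<close> to \<open>j\<close>, in particular each one whose order is
  at most that of \<open>X\<close>. So, for \<open>r\<close> the order of \<open>X\<close>, the set of members of order at most
  \<open>r\<close> has grown strictly. Relating chains in this way, with \<open>r\<close> depending on the pair of
  chains, gives a strict partial order (\<open>low_order_maximal_exists\<close>), and as \<open>D\<close> has
  finitely many separations a maximal chain exists. It is linked.
\<close>

section \<open>The lattice of separations\<close>

definition sep_meet :: "'a set \<times> 'a set \<Rightarrow> 'a set \<times> 'a set \<Rightarrow> 'a set \<times> 'a set" where
  "sep_meet S T = (fst S \<inter> fst T, snd S \<union> snd T)"

definition sep_join :: "'a set \<times> 'a set \<Rightarrow> 'a set \<times> 'a set \<Rightarrow> 'a set \<times> 'a set" where
  "sep_join S T = (fst S \<union> fst T, snd S \<inter> snd T)"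

lemma sep_meet_in_dseparations:
  assumes "S \<in> dseparations D" "T \<in> dseparations D"
  shows "sep_meet S T \<in> dseparations D"
  using assms unfolding dseparations_def sep_meet_def by (cases S; cases T) auto

lemma sep_join_in_dseparations:
  assumes "S \<in> dseparations D" "T \<in> dseparations D"
  shows "sep_join S T \<in> dseparations D"
  using assms unfolding dseparations_def sep_join_def by (cases S; cases T) auto

lemma sep_meet_absorb: "sep_le S T \<Longrightarrow> sep_meet S T = S"
  and sep_meet_absorb2: "sep_le T S \<Longrightarrow> sep_meet S T = T"
  and sep_join_absorb: "sep_le T S \<Longrightarrow> sep_join S T = S"
  unfolding sep_le_def sep_meet_def sep_join_def by (auto simp: prod_eq_iff)

lemma sep_le_refl: "sep_le S S"
  unfolding sep_le_def by simp

lemma sep_le_trans: "sep_le S T \<Longrightarrow> sep_le T U \<Longrightarrow> sep_le S U"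
  unfolding sep_le_def by blast

lemma sep_le_antisym: "sep_le S T \<Longrightarrow> sep_le T S \<Longrightarrow> S = T"
  unfolding sep_le_def by (auto simp: prod_eq_iff)

lemma finite_dseparations:
  assumes "finite (pverts D)"
  shows "finite (dseparations D)"
  by (rule finite_subset[of _ "Pow (pverts D) \<times> Pow (pverts D)"])
    (use assms in \<open>auto simp: dseparations_def\<close>)

lemma dseparations_cover: "S \<in> dseparations D \<Longrightarrow> fst S \<union> snd S = pverts D"
  unfolding dseparations_def by (cases S) simp

text \<open>
  The pairs need not be separations: the lemma is applied to the orders of separations and also to
  bags, where \<open>S\<close> consists of the first side of one separation and the second side of its
  predecessor.
\<close>

lemma sep_order_submodular:
  assumes "finite (fst S)" "finite (fst T)"
  shows "sep_order (sep_meet S T) + sep_order (sep_join S T) \<le> sep_order S + sep_order T"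
proof -
  let ?M = "fst (sep_meet S T) \<inter> snd (sep_meet S T)"
  let ?J = "fst (sep_join S T) \<inter> snd (sep_join S T)"
  let ?S = "fst S \<inter> snd S" and ?T = "fst T \<inter> snd T"
  have fin: "finite ?M" "finite ?J" "finite ?S" "finite ?T"
    using assms unfolding sep_meet_def sep_join_def by auto
  have "card ?M + card ?J = card (?M \<union> ?J) + card (?M \<inter> ?J)"
    by (rule card_Un_Int[OF fin(1,2)])
  also have "\<dots> \<le> card (?S \<union> ?T) + card (?S \<inter> ?T)"
    by (intro add_mono card_mono) (use fin in \<open>auto simp: sep_meet_def sep_join_def\<close>)
  also have "\<dots> = card ?S + card ?T"
    by (rule card_Un_Int[OF fin(3,4), symmetric])
  finally show ?thesis unfolding sep_order_def .
qed

section \<open>Path-decompositions as chains of separations\<close>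

definition separation_chain ::
    "'a pair_pre_digraph \<Rightarrow> nat \<Rightarrow> (nat \<Rightarrow> 'a set \<times> 'a set) \<Rightarrow> bool" where
  "separation_chain D n C \<longleftrightarrow>
     1 \<le> n \<and> C 0 = ({}, pverts D) \<and> C n = (pverts D, {}) \<and>
     (\<forall>k\<le>n. C k \<in> dseparations D) \<and> (\<forall>k<n. sep_le (C k) (C (Suc k)))"

definition chain_bag :: "(nat \<Rightarrow> 'a set \<times> 'a set) \<Rightarrow> nat \<Rightarrow> 'a set" where
  "chain_bag C k = fst (C (Suc k)) \<inter> snd (C k)"

lemma separation_chain_mono:
  assumes "separation_chain D n C" "k \<le> l" "l \<le> n"
  shows "sep_le (C k) (C l)"
  using assms(2,3)
proof (induction l rule: dec_induct)
  case base
  show ?case by (rule sep_le_refl)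
next
  case (step l)
  then have "sep_le (C l) (C (Suc l))"
    using assms(1) unfolding separation_chain_def by auto
  then show ?case using step sep_le_trans by (metis Suc_leD)
qed

text \<open>
  A vertex of the left-hand side lies in some bag up to \<open>W (k+1)\<close> and in some bag from
  \<open>W (k+1)\<close> on, hence in \<open>W (k+1)\<close> by the interval condition.
\<close>

lemma dpd_bag_eq:
  assumes "directed_path_decomposition D n W" "k < n"
  shows "chain_bag (induced_sep n W) k = W (Suc k)"
proof
  have inter: "\<forall>i\<in>{1..n}. \<forall>j\<in>{1..n}. \<forall>l\<in>{1..n}. i < j \<and> j < l \<longrightarrow> W i \<inter> W l \<subseteq> W j"
    using assms(1) unfolding directed_path_decomposition_def by blast
  show "W (Suc k) \<subseteq> chain_bag (induced_sep n W) k"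
    using assms(2) unfolding chain_bag_def induced_sep_def by fastforce
  show "chain_bag (induced_sep n W) k \<subseteq> W (Suc k)"
  proof
    fix x assume "x \<in> chain_bag (induced_sep n W) k"
    then obtain a c where ac: "1 \<le> a" "a \<le> Suc k" "Suc k \<le> c" "c \<le> n" "x \<in> W a" "x \<in> W c"
      unfolding chain_bag_def induced_sep_def by auto
    show "x \<in> W (Suc k)"
    proof (cases "a = Suc k \<or> c = Suc k")
      case False
      then have "a < Suc k" "Suc k < c" using ac by auto
      then have "W a \<inter> W c \<subseteq> W (Suc k)" using inter ac assms(2) by simp
      then show ?thesis using ac by blast
    qed (use ac in blast)
  qed
qed

lemma separation_chain_if_dpd:
  assumes "directed_path_decomposition D n W"
  shows "separation_chain D n (induced_sep n W)"
proof -
  have n: "1 \<le> n" and un: "pverts D = (\<Union>i\<in>{1..n}. W i)"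
    using assms unfolding directed_path_decomposition_def by blast+
  have first: "induced_sep n W 0 = ({}, pverts D)" and last: "induced_sep n W n = (pverts D, {})"
    unfolding induced_sep_def un by auto
  have "induced_sep n W k \<in> dseparations D" if kn: "k \<le> n" for k
  proof -
    consider "k = 0" | "k = n" | "1 \<le> k" "k \<le> n - 1" using kn by linarith
    then show ?thesis
    proof cases
      case 3
      then show ?thesis using induced_sep_in_dseparations[OF assms] by blast
    qed (auto simp: first last dseparations_def simp del: One_nat_def)
  qed
  then show ?thesis
    unfolding separation_chain_def using n first last induced_sep_le[of _ "Suc _" n W] by simp
qed

text \<open>Bags of a decomposition are numbered from 1, those of a chain from 0.\<close>

definition chain_decomposition :: "(nat \<Rightarrow> 'a set \<times> 'a set) \<Rightarrow> nat \<Rightarrow> 'a set" where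
  "chain_decomposition C i = chain_bag C (i - 1)"

text \<open>A vertex lies in the bag just before the first separation that has it on its first side.\<close>

lemma fst_chain_iff:
  assumes "separation_chain D n C" "k \<le> n"
  shows "x \<in> fst (C k) \<longleftrightarrow> (\<exists>l<k. x \<in> chain_bag C l)"
proof
  assume x: "x \<in> fst (C k)"
  define l where "l = (LEAST l. x \<in> fst (C l))"
  have l: "x \<in> fst (C l)" "l \<le> k"
    unfolding l_def using x by (rule LeastI, rule Least_le)
  have "x \<notin> fst (C 0)" using assms(1) unfolding separation_chain_def by simp
  then obtain m where m: "l = Suc m" using l(1) by (cases l) auto
  have "x \<notin> fst (C m)" using not_less_Least[of m "\<lambda>l. x \<in> fst (C l)"] m l_def by simp
  moreover have "C m \<in> dseparations D" "C l \<in> dseparations D"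
    using assms l(2) m unfolding separation_chain_def by auto
  ultimately have "x \<in> snd (C m)" using l(1) dseparations_cover by blast
  then have "m < k" "x \<in> chain_bag C m" using l m unfolding chain_bag_def by auto
  then show "\<exists>l<k. x \<in> chain_bag C l" by blast
next
  assume "\<exists>l<k. x \<in> chain_bag C l"
  then obtain l where "l < k" "x \<in> fst (C (Suc l))" unfolding chain_bag_def by auto
  then show "x \<in> fst (C k)"
    using separation_chain_mono[OF assms(1), of "Suc l" k] assms(2) unfolding sep_le_def by auto
qed

text \<open>Dually, the last separation with the vertex on its second side determines a bag.\<close>

lemma snd_chain_iff:
  assumes "separation_chain D n C" "k \<le> n"
  shows "x \<in> snd (C k) \<longleftrightarrow> (\<exists>l\<in>{k..<n}. x \<in> chain_bag C l)"
proof
  assume x: "x \<in> snd (C k)"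
  define l where "l = (GREATEST l. l \<le> n \<and> x \<in> snd (C l))"
  have l: "l \<le> n" "x \<in> snd (C l)"
    using GreatestI_nat[of "\<lambda>l. l \<le> n \<and> x \<in> snd (C l)" k n] x assms(2) unfolding l_def by auto
  have max: "m \<le> l" if "m \<le> n" "x \<in> snd (C m)" for m
    unfolding l_def by (rule Greatest_le_nat[where b = n]) (use that in auto)
  have "x \<notin> snd (C n)" using assms(1) unfolding separation_chain_def by simp
  then have ln: "l < n" using l by (metis le_neq_implies_less)
  then have "x \<notin> snd (C (Suc l))" using max[of "Suc l"] by auto
  moreover have "C l \<in> dseparations D" "C (Suc l) \<in> dseparations D"
    using assms ln unfolding separation_chain_def by auto
  ultimately have "x \<in> fst (C (Suc l))" using l(2) dseparations_cover by blast
  then show "\<exists>l\<in>{k..<n}. x \<in> chain_bag C l"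
    using l ln max[of k] x assms(2) unfolding chain_bag_def by auto
next
  assume "\<exists>l\<in>{k..<n}. x \<in> chain_bag C l"
  then obtain l where "k \<le> l" "l < n" "x \<in> snd (C l)" unfolding chain_bag_def by auto
  then show "x \<in> snd (C k)"
    using separation_chain_mono[OF assms(1), of k l] unfolding sep_le_def by auto
qed

lemma induced_sep_chain_decomposition:
  assumes "separation_chain D n C" "k \<le> n"
  shows "induced_sep n (chain_decomposition C) k = C k"
proof -
  have indices: "{1..k} = Suc ` {..<k}" "{k+1..n} = Suc ` {k..<n}"
    by (simp_all only: image_Suc_lessThan image_Suc_atLeastLessThan
      atLeastLessThanSuc_atLeastAtMost flip: Suc_eq_plus1)
  have "(\<Union>i\<in>{1..k}. chain_decomposition C i) = fst (C k)"
    unfolding indices chain_decomposition_def using fst_chain_iff[OF assms] by fastforce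
  moreover have "(\<Union>i\<in>{k+1..n}. chain_decomposition C i) = snd (C k)"
    unfolding indices chain_decomposition_def using snd_chain_iff[OF assms] by fastforce
  ultimately show ?thesis unfolding induced_sep_def by simp
qed

lemma dpd_if_separation_chain:
  assumes D: "pair_wf_digraph D" and C: "separation_chain D n C"
  shows "directed_path_decomposition D n (chain_decomposition C)"
proof -
  interpret pair_wf_digraph D by fact
  let ?W = "chain_decomposition C"
  have n: "1 \<le> n" and first: "C 0 = ({}, pverts D)" and sep: "\<And>k. k \<le> n \<Longrightarrow> C k \<in> dseparations D"
    using C unfolding separation_chain_def by auto
  have W: "?W (Suc k) = chain_bag C k" for k
    unfolding chain_decomposition_def by simp
  have cover: "pverts D = (\<Union>i\<in>{1..n}. ?W i)"
    using induced_sep_chain_decomposition[OF C, of 0] first unfolding induced_sep_def by simp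
  have interval: "?W i \<inter> ?W l \<subseteq> ?W j" if "1 \<le> i" "i < j" "j < l" "l \<le> n" for i j l
  proof -
    have "sep_le (C i) (C j)" "sep_le (C (j - 1)) (C (l - 1))"
      using that by (auto intro!: separation_chain_mono[OF C])
    then show ?thesis
      using that unfolding chain_decomposition_def chain_bag_def sep_le_def by auto
  qed
  have edge: "\<exists>i\<in>{1..n}. \<exists>j\<in>{1..n}. i \<le> j \<and> x \<in> ?W i \<and> y \<in> ?W j"
    if e: "(x, y) \<in> parcs D" for x y
  proof -
    have x: "x \<in> pverts D" and y: "y \<in> pverts D" using in_arcsD1[OF e] in_arcsD2[OF e] .
    \<comment> \<open>Right after the last bag with \<open>y\<close>, the separation has \<open>y\<close> only on its first side.
      As no edge may cross it backwards, \<open>x\<close> is on the first side too, hence in this bag or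
      an earlier one.\<close>
    define l where "l = (GREATEST l. l < n \<and> y \<in> chain_bag C l)"
    have "\<exists>l. l < n \<and> y \<in> chain_bag C l" using snd_chain_iff[OF C, of 0 y] first y by auto
    then obtain l0 where l0: "l0 < n \<and> y \<in> chain_bag C l0" by blast
    then have l: "l < n \<and> y \<in> chain_bag C l"
      unfolding l_def by (rule GreatestI_nat[where b = n]) auto
    have max: "m \<le> l" if "m < n" "y \<in> chain_bag C m" for m
      unfolding l_def by (rule Greatest_le_nat[where b = n]) (use that in auto)
    have "y \<notin> snd (C (Suc l))"
      using snd_chain_iff[OF C, of "Suc l" y] l max by fastforce
    then have "x \<in> fst (C (Suc l))"
      using sep[of "Suc l"] l e x y unfolding dseparations_def by (cases "C (Suc l)") fastforce
    then obtain m where "m < Suc l" "x \<in> chain_bag C m"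
      using fst_chain_iff[OF C, of "Suc l" x] l by auto
    then show ?thesis using l
      by (intro bexI[of _ "Suc m"] bexI[of _ "Suc l"] conjI) (simp_all add: W)
  qed
  show ?thesis
    unfolding directed_path_decomposition_def
  proof (intro conjI)
    show "\<forall>i\<in>{1..n}. ?W i \<subseteq> pverts D" using cover by blast
    show "\<forall>i\<in>{1..n}. \<forall>j\<in>{1..n}. \<forall>l\<in>{1..n}. i < j \<and> j < l \<longrightarrow> ?W i \<inter> ?W l \<subseteq> ?W j"
      using interval by (metis atLeastAtMost_iff)
    show "\<forall>(x, y)\<in>parcs D. \<exists>i\<in>{1..n}. \<exists>j\<in>{1..n}. i \<le> j \<and> x \<in> ?W i \<and> y \<in> ?W j"
      using edge by blast
  qed (use n cover in simp_all)
qed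

section \<open>Splicing a separation into a chain\<close>

text \<open>
  The meets of \<open>C 0, \<dots>, C j\<close> with \<open>X\<close>, followed by the joins of \<open>C (i+1), \<dots>, C n\<close>
  with \<open>X\<close>. When \<open>X\<close> lies between \<open>C i\<close> and \<open>C j\<close>, the indices before \<open>i\<close>
  and, up to the shift, those after \<open>j\<close> keep their separations.
\<close>

definition splice ::
    "nat \<Rightarrow> nat \<Rightarrow> 'a set \<times> 'a set \<Rightarrow> (nat \<Rightarrow> 'a set \<times> 'a set) \<Rightarrow> nat \<Rightarrow> 'a set \<times> 'a set" where
  "splice i j X C k = (if k \<le> j then sep_meet (C k) X else sep_join (C (k - (j - i))) X)"

text \<open>
  The joins with \<open>X\<close> of the members up to \<open>C j\<close> lie between \<open>C i\<close> and \<open>C j\<close>, so they have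
  order at least that of \<open>X\<close>. The meet and the join of \<open>X\<close> with the pair that defines an old
  bag have together at most the size of that bag plus the order of \<open>X\<close>. As the join contains the
  overlap of one of the former joins, the meet is left with at most the size of the old bag. The
  bound for the join bags is dual, using the meets from \<open>C i\<close> on.
\<close>

lemma chain_splice:
  assumes C: "separation_chain D n C" and fin: "finite (pverts D)"
    and ij: "i < j" "j \<le> n"
    and X: "X \<in> dseparations D" "sep_le (C i) X" "sep_le X (C j)"
    and min: "\<And>Y. Y \<in> dseparations D \<Longrightarrow> sep_le (C i) Y \<Longrightarrow> sep_le Y (C j) \<Longrightarrow>
      sep_order X \<le> sep_order Y"
    and bags: "\<And>k. k < n \<Longrightarrow> card (chain_bag C k) \<le> b"
  shows "separation_chain D (n + (j - i)) (splice i j X C)"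
    and "\<And>k. k < n + (j - i) \<Longrightarrow> card (chain_bag (splice i j X C) k) \<le> b"
    and "X \<in> splice i j X C ` {..n + (j - i)}"
    and "\<And>k. k \<le> n \<Longrightarrow> k < i \<or> j < k \<Longrightarrow> C k \<in> splice i j X C ` {..n + (j - i)}"
proof -
  let ?C = "splice i j X C" and ?n = "n + (j - i)"
  have sep: "\<And>k. k \<le> n \<Longrightarrow> C k \<in> dseparations D" and n: "1 \<le> n"
    using C unfolding separation_chain_def by auto
  note mono = separation_chain_mono[OF C]
  have below: "sep_le (C k) X" if "k \<le> i" for k
    using mono[of k i] that ij X(2) sep_le_trans by (metis less_imp_le_nat order_trans)
  have above: "sep_le X (C k)" if "j \<le> k" "k \<le> n" for k
    using mono[of j k] that X(3) sep_le_trans by blast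
  have at_join: "?C (k + (j - i)) = sep_join (C k) X" if "i \<le> k" "k \<le> n" for k
  proof (cases "k = i")
    case True
    \<comment> \<open>The two halves overlap in \<open>X\<close>, as the meet with \<open>C j\<close> and as the join with \<open>C i\<close>.\<close>
    then have "?C (k + (j - i)) = X"
      using ij sep_meet_absorb2[OF X(3)] unfolding splice_def by simp
    also have "X = sep_join (C k) X"
      using X(2) True unfolding sep_le_def sep_join_def by (auto simp: prod_eq_iff)
    finally show ?thesis .
  qed (use that ij in \<open>auto simp: splice_def\<close>)
  have at_meet: "?C k = sep_meet (C k) X" if "k \<le> j" for k
    using that unfolding splice_def by simp
  have split: thesis
    if "k < ?n" "k < j \<Longrightarrow> thesis" "\<And>m. k = m + (j - i) \<Longrightarrow> i \<le> m \<Longrightarrow> m < n \<Longrightarrow> thesis" for k thesis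
    using that(1) that(2) that(3)[of "k - (j - i)"] ij by linarith
  have step: "sep_le (?C k) (?C (Suc k))" if "k < ?n" for k
    using that
  proof (rule split)
    assume "k < j"
    then show ?thesis
      using mono[of k "Suc k"] ij at_meet[of k] at_meet[of "Suc k"]
      unfolding sep_le_def sep_meet_def by auto
  next
    fix m assume "k = m + (j - i)" "i \<le> m" "m < n"
    then show ?thesis
      using mono[of m "Suc m"] at_join[of m] at_join[of "Suc m"]
      unfolding sep_le_def sep_join_def by auto
  qed
  have seps: "?C k \<in> dseparations D" if "k \<le> ?n" for k
    unfolding splice_def using that sep X(1) ij
    by (auto intro: sep_meet_in_dseparations sep_join_in_dseparations)
  have "?C 0 = C 0"
    using sep_meet_absorb[OF below[of 0]] at_meet[of 0] by simp
  moreover have "?C ?n = C n"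
    using at_join[of n] ij sep_join_absorb[OF above[of n]] by simp
  ultimately show "separation_chain D ?n ?C"
    using C step seps unfolding separation_chain_def by simp
  have finite_sep: "finite (fst S)" if "S \<in> dseparations D" for S
    using dseparations_cover[OF that] fin by (metis finite_Un)
  have submod: "sep_order (sep_meet (fst (C (Suc k)), snd (C k)) X)
      + sep_order (sep_join (fst (C (Suc k)), snd (C k)) X) \<le> card (chain_bag C k) + sep_order X"
    if "k < n" for k
    using sep_order_submodular[of "(fst (C (Suc k)), snd (C k))" X] finite_sep sep X(1) that
    by (simp add: sep_order_def chain_bag_def)
  have finite_join: "finite (fst (sep_join S T) \<inter> A)" and finite_meet: "finite (fst (sep_meet S T) \<inter> A)"
    if "finite (fst S)" "finite (fst T)" for S T :: "'a set \<times> 'a set" and A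
    using that unfolding sep_join_def sep_meet_def by auto
  show "card (chain_bag ?C k) \<le> b" if "k < ?n" for k
    using that
  proof (rule split)
    assume k: "k < j"
    let ?P = "(fst (C (Suc k)), snd (C k))"
    have "sep_order X \<le> sep_order (sep_join (C k) X)"
    proof (rule min)
      show "sep_join (C k) X \<in> dseparations D" using k ij sep X(1) by (simp add: sep_join_in_dseparations)
      show "sep_le (C i) (sep_join (C k) X)" using X(2) unfolding sep_le_def sep_join_def by auto
      show "sep_le (sep_join (C k) X) (C j)"
        using X(3) mono[of k j] k ij unfolding sep_le_def sep_join_def by auto
    qed
    also have "\<dots> \<le> sep_order (sep_join ?P X)"
      unfolding sep_order_def
    proof (rule card_mono)
      show "finite (fst (sep_join ?P X) \<inter> snd (sep_join ?P X))"
        using finite_sep sep X(1) k ij by (intro finite_join) auto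
      show "fst (sep_join (C k) X) \<inter> snd (sep_join (C k) X) \<subseteq> fst (sep_join ?P X) \<inter> snd (sep_join ?P X)"
        using mono[of k "Suc k"] k ij unfolding sep_le_def sep_join_def by auto
    qed
    finally have "sep_order (sep_meet ?P X) \<le> card (chain_bag C k)"
      using submod[of k] k ij by linarith
    moreover have "chain_bag ?C k = fst (sep_meet ?P X) \<inter> snd (sep_meet ?P X)"
      using k unfolding chain_bag_def at_meet[OF less_imp_le[OF k]] at_meet[OF Suc_leI[OF k]]
      by (simp add: sep_meet_def)
    ultimately show ?thesis
      using bags[of k] k ij unfolding sep_order_def by simp
  next
    fix m assume m: "k = m + (j - i)" "i \<le> m" "m < n"
    let ?P = "(fst (C (Suc m)), snd (C m))"
    have "sep_order X \<le> sep_order (sep_meet (C (Suc m)) X)"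
    proof (rule min)
      show "sep_meet (C (Suc m)) X \<in> dseparations D" using m sep X(1) by (simp add: sep_meet_in_dseparations)
      show "sep_le (C i) (sep_meet (C (Suc m)) X)"
        using X(2) mono[of i "Suc m"] m unfolding sep_le_def sep_meet_def by auto
      show "sep_le (sep_meet (C (Suc m)) X) (C j)" using X(3) unfolding sep_le_def sep_meet_def by auto
    qed
    also have "\<dots> \<le> sep_order (sep_meet ?P X)"
      unfolding sep_order_def
    proof (rule card_mono)
      show "finite (fst (sep_meet ?P X) \<inter> snd (sep_meet ?P X))"
        using finite_sep sep X(1) m by (intro finite_meet) auto
      show "fst (sep_meet (C (Suc m)) X) \<inter> snd (sep_meet (C (Suc m)) X)
          \<subseteq> fst (sep_meet ?P X) \<inter> snd (sep_meet ?P X)"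
        using mono[of m "Suc m"] m unfolding sep_le_def sep_meet_def by auto
    qed
    finally have "sep_order (sep_join ?P X) \<le> card (chain_bag C m)"
      using submod[of m] m by linarith
    moreover have "chain_bag ?C k = fst (sep_join ?P X) \<inter> snd (sep_join ?P X)"
      using m at_join[of m] at_join[of "Suc m"] unfolding chain_bag_def
      by (simp add: sep_join_def)
    ultimately show ?thesis
      using bags[of m] m unfolding sep_order_def by simp
  qed
  have new: "?C l \<in> ?C ` {..?n}" if "l \<le> ?n" for l
    using that by simp
  have "?C j = X" using at_meet[of j] sep_meet_absorb2[OF X(3)] by simp
  then show "X \<in> ?C ` {..?n}" using new[of j] ij by (simp only: trans_le_add1)
  show "C k \<in> ?C ` {..?n}" if k: "k \<le> n" "k < i \<or> j < k" for k
    using k(2)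
  proof
    assume "k < i"
    then have "?C k = C k" using at_meet[of k] sep_meet_absorb[OF below[of k]] ij by simp
    then show ?thesis using new[of k] k(1) by (simp only: trans_le_add1)
  next
    assume "j < k"
    then have "?C (k + (j - i)) = C k"
      using at_join[of k] sep_join_absorb[OF above[of k]] k(1) ij by simp
    then show ?thesis using new[of "k + (j - i)"] k(1) by (simp only: add_right_mono)
  qed
qed

section \<open>Maximal chains are linked\<close>

text \<open>
  Gaining members of value at most \<open>r\<close> without losing any of these, for some \<open>r\<close>, is a
  transitive relation: two such steps combine at the smaller of their thresholds.
\<close>

lemma low_order_maximal_exists:
  fixes f :: "'b \<Rightarrow> nat"
  assumes "finite \<F>" "\<F> \<noteq> {}"
  obtains S where "S \<in> \<F>" "\<And>T r. T \<in> \<F> \<Longrightarrow> \<not> {s \<in> S. f s \<le> r} \<subset> {s \<in> T. f s \<le> r}"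
proof -
  define R where "R S T \<longleftrightarrow> (\<exists>r. {s \<in> S. f s \<le> r} \<subset> {s \<in> T. f s \<le> r})" for S T
  have lower: "{s \<in> A. f s \<le> r} \<subseteq> {s \<in> B. f s \<le> r}"
    if "{s \<in> A. f s \<le> p} \<subset> {s \<in> B. f s \<le> p}" "r \<le> p" for A B p r
    using that by force
  have trans: "R S U" if ST: "R S T" and TU: "R T U" for S T U
  proof -
    obtain p where p: "{s \<in> S. f s \<le> p} \<subset> {s \<in> T. f s \<le> p}"
      using ST unfolding R_def by (elim exE)
    obtain q where q: "{s \<in> T. f s \<le> q} \<subset> {s \<in> U. f s \<le> q}"
      using TU unfolding R_def by (elim exE)
    show ?thesis
    proof (cases "p \<le> q")
      case True
      then show ?thesis unfolding R_def using psubset_subset_trans[OF p lower[OF q]] by blast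
    next
      case False
      then have "q \<le> p" by simp
      then show ?thesis unfolding R_def using subset_psubset_trans[OF lower[OF p] q] by blast
    qed
  qed
  have irrefl: "\<not> R S S" for S unfolding R_def by simp
  have "\<exists>S\<in>\<F>. \<forall>T\<in>\<F>. T \<noteq> S \<longrightarrow> \<not> R S T"
  proof (rule Finite_Set.bex_max_element)
    show "asymp_on \<F> R" using trans irrefl by (metis asymp_onI)
    show "transp_on \<F> R" using trans by (metis transp_onI)
  qed (fact assms)+
  then obtain S where S: "S \<in> \<F>" "\<forall>T\<in>\<F>. \<not> R S T"
    using irrefl by metis
  show thesis by (rule that[OF S(1)]) (use S(2) in \<open>unfold R_def, blast\<close>)
qed

lemma linked_if_low_order_maximal:
  assumes D: "pair_fin_digraph D" and C: "separation_chain D n C"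
    and bags: "\<And>k. k < n \<Longrightarrow> card (chain_bag C k) \<le> b"
    and maximal: "\<And>m B r. separation_chain D m B \<Longrightarrow> (\<And>k. k < m \<Longrightarrow> card (chain_bag B k) \<le> b) \<Longrightarrow>
      \<not> {S \<in> C ` {..n}. sep_order S \<le> r} \<subset> {S \<in> B ` {..m}. sep_order S \<le> r}"
  shows "linked D n (chain_decomposition C)"
  unfolding linked_def
proof (intro allI impI, elim conjE)
  interpret pair_fin_digraph D by fact
  fix i j assume "1 \<le> i" and ij: "i < j" "j \<le> n - 1"
  then have jn: "j \<le> n" by simp
  let ?I = "induced_sep n (chain_decomposition C)"
  let ?O = "sep_order ` C ` {i..j}"
  let ?L = "{sep_order X | X. X \<in> dseparations D \<and> sep_le (C i) X \<and> sep_le X (C j)}"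
  have sep: "C k \<in> dseparations D" if "k \<le> n" for k
    using C that unfolding separation_chain_def by auto
  note mono = separation_chain_mono[OF C]
  have I: "?I k = C k" if "k \<le> n" for k
    using induced_sep_chain_decomposition[OF C that] .
  have orders: "sep_order ` ?I ` {i..j} = sep_order ` C ` {i..j}"
    using I jn by simp
  have "sep_le (C i) (C j)" by (rule mono) (use ij jn in simp_all)
  note L = sep_lambda_range[OF D sep[of i] sep[of j] this]
  have finL: "finite ?L" and neL: "?L \<noteq> {}"
    using L ij jn by simp_all
  have sub: "?O \<subseteq> ?L"
  proof
    fix r assume "r \<in> ?O"
    then obtain l where l: "r = sep_order (C l)" "i \<le> l" "l \<le> j" by auto
    moreover have "C l \<in> dseparations D" using sep l jn by simp
    moreover have "sep_le (C i) (C l)" "sep_le (C l) (C j)" using mono l jn by simp_all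
    ultimately show "r \<in> ?L" by blast
  qed
  have finO: "finite ?O" and neO: "?O \<noteq> {}"
    using ij by simp_all
  obtain X where X: "X \<in> dseparations D" "sep_le (C i) X" "sep_le X (C j)"
    and Xmin: "sep_order X = Min ?L"
    using Min_in[OF finL neL] by (elim CollectE exE conjE) simp
  have le: "sep_order X \<le> sep_order Y"
    if "Y \<in> dseparations D" "sep_le (C i) Y" "sep_le Y (C j)" for Y
    unfolding Xmin by (rule Min_le[OF finL]) (use that in blast)
  have "Min ?O = Min ?L"
  proof (rule ccontr)
    assume "Min ?O \<noteq> Min ?L"
    then have "Min ?L < Min ?O" using Min_antimono[OF sub neO finL] by simp
    then have big: "sep_order X < sep_order (C l)" if "i \<le> l" "l \<le> j" for l
      using Min_le[OF finO, of "sep_order (C l)"] that Xmin by simp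
    let ?m = "n + (j - i)" and ?B = "splice i j X C"
    note spliced = chain_splice[OF C finite_verts ij(1) jn X le bags]
    \<comment> \<open>Outside the range from \<open>i\<close> to \<open>j\<close>, a member equal to \<open>X\<close> would be squeezed into
      equality with \<open>C i\<close> or \<open>C j\<close>, whose orders are too large.\<close>
    have "X \<notin> C ` {..n}"
    proof
      assume "X \<in> C ` {..n}"
      then obtain k where k: "X = C k" "k \<le> n" by auto
      consider "k < i" | "i \<le> k" "k \<le> j" | "j < k" by linarith
      then show False
      proof cases
        case 1
        then have "X = C i" using mono[of k i] k X ij jn by (intro sep_le_antisym) auto
        then show False using big[of i] ij by simp
      next
        case 2
        then show False using big[of k] k by simp
      next
        case 3
        then have "X = C j" using mono[of j k] k X by (intro sep_le_antisym) auto
        then show False using big[of j] ij by simp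
      qed
    qed
    moreover have "S \<in> ?B ` {..?m}" if S: "S \<in> C ` {..n}" "sep_order S \<le> sep_order X" for S
    proof -
      obtain k where k: "S = C k" "k \<le> n" using S(1) by auto
      then have "k < i \<or> j < k" using big[of k] S(2) by fastforce
      then show ?thesis using spliced(4)[of k] k by simp
    qed
    ultimately have "{S \<in> C ` {..n}. sep_order S \<le> sep_order X}
        \<subset> {S \<in> ?B ` {..?m}. sep_order S \<le> sep_order X}"
      using spliced(3) by blast
    then show False using maximal[OF spliced(1,2)] by blast
  qed
  then show "Min {sep_order (?I l) | l. i \<le> l \<and> l \<le> j} = sep_lambda D (?I i) (?I j)"
    using orders I[of i] I[of j] ij jn unfolding sep_lambda_def
    by (simp add: image_image setcompr_eq_image atLeastAtMost_def atLeast_def atMost_def Int_def)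
qed

theorem theorem6:
  fixes D :: "'a pair_pre_digraph"
  assumes "pair_fin_digraph D"
  shows "\<exists>n W. directed_path_decomposition D n W \<and> linked D n W \<and> dpd_width n W = dpw D"
proof -
  interpret pair_fin_digraph D by fact
  obtain n W where W: "directed_path_decomposition D n W" "dpd_width n W = dpw D"
    using dpw_attained_and_least(1)[OF assms] by blast
  define b where "b = Max ((\<lambda>i. card (W i)) ` {1..n})"
  define narrow where "narrow m C \<longleftrightarrow>
    separation_chain D m C \<and> (\<forall>k<m. card (chain_bag C k) \<le> b)" for m C
  define \<F> where "\<F> = {C ` {..m} | m C. narrow m C}"
  have "card (W (Suc k)) \<le> b" if "k < n" for k
    unfolding b_def using that by (intro Max_ge) auto
  then have "narrow n (induced_sep n W)"
    unfolding narrow_def using separation_chain_if_dpd[OF W(1)] dpd_bag_eq[OF W(1)] by simp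
  then have "\<F> \<noteq> {}" unfolding \<F>_def by blast
  have "\<F> \<subseteq> Pow (dseparations D)"
    unfolding \<F>_def narrow_def separation_chain_def by auto
  then have "finite \<F>" using finite_dseparations[OF finite_verts] by (rule finite_subset[OF _ finite_Pow_iff[THEN iffD2]])
  obtain S where S: "S \<in> \<F>"
    "\<And>T r. T \<in> \<F> \<Longrightarrow> \<not> {s \<in> S. sep_order s \<le> r} \<subset> {s \<in> T. sep_order s \<le> r}"
    by (rule low_order_maximal_exists[OF \<open>finite \<F>\<close> \<open>\<F> \<noteq> {}\<close>, of sep_order]) blast
  then obtain m C where m: "narrow m C" "S = C ` {..m}" unfolding \<F>_def by blast
  then have C: "separation_chain D m C" and bags: "\<And>k. k < m \<Longrightarrow> card (chain_bag C k) \<le> b"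
    unfolding narrow_def by auto
  let ?W = "chain_decomposition C"
  have dpd: "directed_path_decomposition D m ?W" using dpd_if_separation_chain[OF pair_wf_digraph_axioms C] .
  have "linked D m ?W"
  proof (rule linked_if_low_order_maximal[OF assms C bags])
    fix l B r
    assume "separation_chain D l B" "\<And>k. k < l \<Longrightarrow> card (chain_bag B k) \<le> b"
    then have "B ` {..l} \<in> \<F>" unfolding \<F>_def narrow_def by blast
    then show "\<not> {S \<in> C ` {..m}. sep_order S \<le> r} \<subset> {S \<in> B ` {..l}. sep_order S \<le> r}"
      using S(2) m(2) by blast
  qed
  moreover have "dpd_width m ?W = dpw D"
  proof (rule antisym)
    have "Max ((\<lambda>i. card (?W i)) ` {1..m}) \<le> b"
      using C bags unfolding separation_chain_def chain_decomposition_def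
      by (subst Max_le_iff) auto
    then show "dpd_width m ?W \<le> dpw D"
      using W(2) unfolding dpd_width_def b_def by linarith
    show "dpw D \<le> dpd_width m ?W" using dpw_attained_and_least(2)[OF assms dpd] .
  qed
  ultimately show ?thesis using dpd by blast
qed

end
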